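(* Let $(x_0,y_0)\in D=\{(x,y)\in\mathbb{R}^2:x>0\}$, $a>0$ and $E=[x_0,x_0+a]\times[y_0,y_0+a]\subset D$. Let $F^0(x_0,y_0)$ be an arbitrarily given orthonormal frame of $\mathbb{R}^4$, and let $F^0(x,y)$ be the orthonormal frame field on $D$ satisfying $dF^0=F^0\Omega$ with this initial condition. For a positive integer $n$ and $(x_p,y_p)\in E$, take a division of $E_p=[x_0,x_p]\times[y_0,y_p]$ (see context) and let $$\underline m:(x_0,y_0)\to(x_p,y_0)\to(x_p,y_p),\qquad \overline m:(x_0,y_0)\to(x_0,y_p)\to(x_p,y_p)$$ be the two paths consisting of one horizontal and one vertical segment (in these orders). Let $F^{\underline\delta_n}(x_p,y_p)$ and $F^{\overline\delta_n}(x_p,y_p)$ be the orthonormal frames at $(x_p,y_p)$ determined from $\underline m$ and $\overline m$, respectively, by the stepping scheme described in the context, starting from $F^{\delta_n}(x_0,y_0)=F^0(x_0,y_0)$. Then $F^{\underline\delta_n}(x_p,y_p)$ and $F^{\overline\delta_n}(x_p,y_p)$ converge to $F^0(x_p,y_p)$ uniformly for all $(x_p,y_p)\in E$ as $n\to\infty$.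
   Context: $X_0(x)=\frac52+\sum_{k\ge1}a_kx^{2k}$ (analytic on $\mathbb{R}$), $a_1=1$, $2(k+1)(4k^2+\frac54)a_{k+1}+(2k-1)a_k=0$ $(k\ge1)$. $h(x,y)=2X_0-xX_0'+y^2\frac{X_0'}{x}+\sqrt5$ (positive). On $D$ put $a_1=\frac{2y}{xh}(X_0+\frac{\sqrt5}{2})$, $b_1=-\frac{1}{xh}(X_0+\frac{\sqrt5}{2}+\sqrt5(x^2-y^2))$, $c_1=-\frac{2}{xh}(X_0+\frac{\sqrt5}{2})$, $a_2=-\frac1h(2X_0+\sqrt5-(x^2+y^2)\frac{X_0'}{x})$, $b_2=-\frac{2y}{h}(\frac{X_0'}{2x}+\sqrt5)$, $c_2=\frac{2y}{h}(X_0''-\frac{X_0'}{x})$, $\Omega_1=\begin{bmatrix}0&a_1&0&0\\-a_1&0&c_1&b_1\\0&-c_1&0&0\\0&-b_1&0&0\end{bmatrix}$, $\Omega_2=\begin{bmatrix}0&0&a_2&0\\0&0&-c_2&0\\-a_2&c_2&0&b_2\\0&0&-b_2&0\end{bmatrix}$, $\Omega=\Omega_1dx+\Omega_2dy$. (The equation $dF=F\Omega$ has a unique solution on $D$ with given orthogonal initial value; frames are $4\times4$ orthogonal matrices.) Division of $E_p$: with $\delta_n:=a/n$, the intervals $[x_0,x_p]$ and $[y_0,y_p]$ are divided into $s$ resp. $t$ sub-intervals of equal length, $x_0<x_1<\dots<x_s=x_p$, $y_0<y_1<\dots<y_t=y_p$, where $0<s,t\le n$, $(x_p-x_0)/s\le\delta_n$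 and $(y_p-y_0)/t\le\delta_n$. Stepping scheme: given an orthogonal matrix $F^{\delta_n}(x_i,y_j)$ at a lattice point, on a horizontal edge, for $x\in[x_i,x_{i+1}]$, $F^{\delta_n}(x,y_j)=F^{\delta_n}(x_i,y_j)\Big(\mathrm{Id}+(x-x_i)\,t_1(x)\big(\Omega_1+\tfrac{x-x_i}{2}\Omega_1^2\big)(x_i,y_j)\Big)$, $t_1(x)=\frac{4}{4+(x-x_i)^2(a_1^2+b_1^2+c_1^2)(x_i,y_j)}$; on a vertical edge, for $y\in[y_j,y_{j+1}]$, $F^{\delta_n}(x_i,y)=F^{\delta_n}(x_i,y_j)\Big(\mathrm{Id}+(y-y_j)\,t_2(y)\big(\Omega_2+\tfrac{y-y_j}{2}\Omega_2^2\big)(x_i,y_j)\Big)$, $t_2(y)=\frac{4}{4+(y-y_j)^2(a_2^2+b_2^2+c_2^2)(x_i,y_j)}$. Applying these successively along the edges of a path from $(x_0,y_0)$ to $(x_p,y_p)$ gives the frame at $(x_p,y_p)$ determined from that path. *)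

theory Defs
  imports "HOL-Analysis.Analysis"
begin

text \<open>The even power series \<open>X\<^sub>0\<close>; the constant term \<open>5/2\<close> is stored as the coefficient of index 0.\<close>

fun X0_coeff :: "nat \<Rightarrow> real" where
  "X0_coeff 0 = 5 / 2"
| "X0_coeff (Suc 0) = 1"
| "X0_coeff (Suc (Suc k)) =
     - ((2 * real (Suc k) - 1) * X0_coeff (Suc k)) /
       (2 * (real (Suc k) + 1) * (4 * (real (Suc k))\<^sup>2 + 5 / 4))"

lemma X0_coeff_recurrence:
  assumes "k \<ge> 1"
  shows "2 * (real k + 1) * (4 * (real k)\<^sup>2 + 5 / 4) * X0_coeff (k + 1)
         + (2 * real k - 1) * X0_coeff k = 0"
proof -
  obtain j where j: "k = Suc j"
    using assms by (cases k) auto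
  have "4 * (real k)\<^sup>2 + 5 / 4 > 0"
    by (intro add_nonneg_pos) auto
  then have "4 * (real k)\<^sup>2 + 5 / 4 \<noteq> 0"
    by linarith
  then show ?thesis
    unfolding j by (simp del: of_nat_Suc)
qed

definition X0 :: "real \<Rightarrow> real" where
  "X0 x = (\<Sum>k. X0_coeff k * x ^ (2 * k))"

abbreviation X0' :: "real \<Rightarrow> real" where
  "X0' \<equiv> deriv X0"

abbreviation X0'' :: "real \<Rightarrow> real" where
  "X0'' \<equiv> deriv X0'"

definition right_half_plane :: "(real \<times> real) set" where
  "right_half_plane = {(x, y). x > 0}"

definition h_fun :: "real \<Rightarrow> real \<Rightarrow> real" where
  "h_fun x y = 2 * X0 x - x * X0' x + y\<^sup>2 * (X0' x / x) + sqrt 5"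

definition a1 :: "real \<Rightarrow> real \<Rightarrow> real" where
  "a1 x y = 2 * y / (x * h_fun x y) * (X0 x + sqrt 5 / 2)"

definition b1 :: "real \<Rightarrow> real \<Rightarrow> real" where
  "b1 x y = - (1 / (x * h_fun x y)) * (X0 x + sqrt 5 / 2 + sqrt 5 * (x\<^sup>2 - y\<^sup>2))"

definition c1 :: "real \<Rightarrow> real \<Rightarrow> real" where
  "c1 x y = - (2 / (x * h_fun x y)) * (X0 x + sqrt 5 / 2)"

definition a2 :: "real \<Rightarrow> real \<Rightarrow> real" where
  "a2 x y = - (1 / h_fun x y) * (2 * X0 x + sqrt 5 - (x\<^sup>2 + y\<^sup>2) * (X0' x / x))"

definition b2 :: "real \<Rightarrow> real \<Rightarrow> real" where
  "b2 x y = - (2 * y / h_fun x y) * (X0' x / (2 * x) + sqrt 5)"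

definition c2 :: "real \<Rightarrow> real \<Rightarrow> real" where
  "c2 x y = 2 * y / h_fun x y * (X0'' x - X0' x / x)"

definition Omega1 :: "real \<Rightarrow> real \<Rightarrow> real^4^4" where
  "Omega1 x y = vector
    [vector [0,          a1 x y,     0,      0],
     vector [- a1 x y,   0,          c1 x y, b1 x y],
     vector [0,          - c1 x y,   0,      0],
     vector [0,          - b1 x y,   0,      0]]"

definition Omega2 :: "real \<Rightarrow> real \<Rightarrow> real^4^4" where
  "Omega2 x y = vector
    [vector [0,          0,          a2 x y,     0],
     vector [0,          0,          - c2 x y,   0],
     vector [- a2 x y,   c2 x y,     0,          b2 x y],
     vector [0,          0,          - b2 x y,   0]]"

text \<open>The matrix-valued one-form \<open>\<Omega> = \<Omega>\<^sub>1 dx + \<Omega>\<^sub>2 dy\<close> at a point, evaluated on a tangent vector.\<close>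

definition Omega :: "real \<times> real \<Rightarrow> real \<times> real \<Rightarrow> real^4^4" where
  "Omega p v = fst v *\<^sub>R Omega1 (fst p) (snd p) + snd v *\<^sub>R Omega2 (fst p) (snd p)"

definition frame_field :: "(real \<times> real \<Rightarrow> real^4^4) \<Rightarrow> bool" where
  "frame_field F \<longleftrightarrow>
     (\<forall>p\<in>right_half_plane.
        orthogonal_matrix (F p) \<and> (F has_derivative (\<lambda>v. F p ** Omega p v)) (at p))"

text \<open>The frame at \<open>(x, y\<^sub>j)\<close>, resp. \<open>(x\<^sub>i, y)\<close>, on the edge leaving the lattice point
  \<open>(x\<^sub>i, y\<^sub>j)\<close>, where \<open>F\<close> is the frame at that lattice point.\<close>

definition horizontal_step :: "real \<Rightarrow> real \<Rightarrow> real^4^4 \<Rightarrow> real \<Rightarrow> real^4^4" where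
  "horizontal_step xi yj F x =
     (let t1 = 4 / (4 + (x - xi)\<^sup>2 * ((a1 xi yj)\<^sup>2 + (b1 xi yj)\<^sup>2 + (c1 xi yj)\<^sup>2))
      in F ** (mat 1 + ((x - xi) * t1) *\<^sub>R
           (Omega1 xi yj + ((x - xi) / 2) *\<^sub>R (Omega1 xi yj ** Omega1 xi yj))))"

definition vertical_step :: "real \<Rightarrow> real \<Rightarrow> real^4^4 \<Rightarrow> real \<Rightarrow> real^4^4" where
  "vertical_step xi yj F y =
     (let t2 = 4 / (4 + (y - yj)\<^sup>2 * ((a2 xi yj)\<^sup>2 + (b2 xi yj)\<^sup>2 + (c2 xi yj)\<^sup>2))
      in F ** (mat 1 + ((y - yj) * t2) *\<^sub>R
           (Omega2 xi yj + ((y - yj) / 2) *\<^sub>R (Omega2 xi yj ** Omega2 xi yj))))"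

text \<open>\<open>division_point u v m i\<close> is the \<open>i\<close>-th point of the division of \<open>[u, v]\<close> into \<open>m\<close>
  sub-intervals of equal length. For \<open>u = v\<close> all points coincide and the steps below are trivial.\<close>

definition division_point :: "real \<Rightarrow> real \<Rightarrow> nat \<Rightarrow> nat \<Rightarrow> real" where
  "division_point u v m i = u + real i * ((v - u) / real m)"

definition admissible_division ::
  "real \<times> real \<Rightarrow> real \<Rightarrow> nat \<Rightarrow> real \<times> real \<Rightarrow> nat \<Rightarrow> nat \<Rightarrow> bool" where
  "admissible_division p0 a n p s t \<longleftrightarrow>
     0 < s \<and> s \<le> n \<and> 0 < t \<and> t \<le> n \<and>
     (fst p - fst p0) / real s \<le> a / real n \<and> (snd p - snd p0) / real t \<le> a / real n"

text \<open>Frame after \<open>i\<close> steps along the horizontal segment from \<open>(x0, y)\<close> to \<open>(xp, y)\<close>, divided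
  into \<open>s\<close> edges, starting with \<open>F\<close>; \<open>vertical_path\<close> is the analogue for the vertical segment
  from \<open>(x, y0)\<close> to \<open>(x, yp)\<close>.\<close>

primrec horizontal_path ::
  "real \<Rightarrow> real \<Rightarrow> nat \<Rightarrow> real \<Rightarrow> real^4^4 \<Rightarrow> nat \<Rightarrow> real^4^4" where
  "horizontal_path x0 xp s y F 0 = F"
| "horizontal_path x0 xp s y F (Suc i) =
     horizontal_step (division_point x0 xp s i) y (horizontal_path x0 xp s y F i)
       (division_point x0 xp s (Suc i))"

primrec vertical_path ::
  "real \<Rightarrow> real \<Rightarrow> nat \<Rightarrow> real \<Rightarrow> real^4^4 \<Rightarrow> nat \<Rightarrow> real^4^4" where
  "vertical_path y0 yp t x F 0 = F"
| "vertical_path y0 yp t x F (Suc j) =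
     vertical_step x (division_point y0 yp t j) (vertical_path y0 yp t x F j)
       (division_point y0 yp t (Suc j))"

text \<open>The frames at \<open>p\<close> obtained along \<open>(x0, y0) \<rightarrow> (xp, y0) \<rightarrow> (xp, yp)\<close>, resp.
  \<open>(x0, y0) \<rightarrow> (x0, yp) \<rightarrow> (xp, yp)\<close>.\<close>

definition lower_frame ::
  "real \<times> real \<Rightarrow> real^4^4 \<Rightarrow> real \<times> real \<Rightarrow> nat \<Rightarrow> nat \<Rightarrow> real^4^4" where
  "lower_frame p0 F p s t =
     vertical_path (snd p0) (snd p) t (fst p)
       (horizontal_path (fst p0) (fst p) s (snd p0) F s) t"

definition upper_frame ::
  "real \<times> real \<Rightarrow> real^4^4 \<Rightarrow> real \<times> real \<Rightarrow> nat \<Rightarrow> nat \<Rightarrow> real^4^4" where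
  "upper_frame p0 F p s t =
     horizontal_path (fst p0) (fst p) s (snd p)
       (vertical_path (snd p0) (snd p) t (fst p0) F t) s"

end

theory Submission
  imports Defs
begin

text \<open>The stepping scheme is a consistent one-step method for the linear equation \<open>dF = F \<Omega>\<close>
  along each edge: one step of length \<open>\<tau>\<close> commits an error \<open>o(\<tau>)\<close>, uniformly on the compact
  square \<open>E\<close>, and the errors add up by a discrete Gronwall inequality. Uniformity needs \<open>\<Omega>\<close> to be continuous on \<open>D\<close>, that is \<open>h > 0\<close>.
  For this, put \<open>t = x\<^sup>2\<close> and \<open>X\<^sub>0(x) = G(t)\<close>: the differential equation behind the recurrence
  has the first integral \<open>4 G' G - 16 (t G'')\<^sup>2 - (5 + 4 t) G'\<^sup>2 = 5\<close>, so \<open>G'\<close> has no zero and is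
  positive, and \<open>2 X\<^sub>0 - x X\<^sub>0' = 2 (G - t G')\<close> is positive as well.\<close>

section \<open>The everywhere convergent series \<open>G\<close>, \<open>G'\<close> and
  \<open>G''\<close> in the variable \<open>t\<close>\<close>

definition X0_sum :: "real \<Rightarrow> real" where
  "X0_sum t = (\<Sum>k. X0_coeff k * t ^ k)"

definition X0_sum1 :: "real \<Rightarrow> real" where
  "X0_sum1 t = (\<Sum>k. diffs X0_coeff k * t ^ k)"

definition X0_sum2 :: "real \<Rightarrow> real" where
  "X0_sum2 t = (\<Sum>k. diffs (diffs X0_coeff) k * t ^ k)"

text \<open>By the recurrence, the quotient of the coefficients of index \<open>m + 1\<close> and
  \<open>m\<close> is at most \<open>1 / (m + 1)\<close> in absolute value for
  \<open>m \<ge> 1\<close>, whence the factorial decay; \<open>5 / 2\<close> is the coefficient of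
  index 0. Comparison with the exponential series then gives convergence for every
  \<open>t\<close>.\<close>

lemma X0_coeff_bound: "\<bar>X0_coeff k\<bar> \<le> (5 / 2) / fact k"
proof (induction k rule: X0_coeff.induct)
  case (3 k)
  define m where "m = real (Suc k)"
  have m: "m \<ge> 1" by (simp add: m_def)
  define d where "d = 2 * (m + 1) * (4 * m\<^sup>2 + 5 / 4)"
  have sq: "m \<le> m\<^sup>2" using m by (simp add: power2_eq_square)
  have d: "d > 0" unfolding d_def using m by (intro mult_pos_pos add_nonneg_pos) auto
  have "(2 * m - 1) * (m + 1) \<le> (2 * (4 * m\<^sup>2 + 5 / 4)) * (m + 1)"
    using m sq by (intro mult_right_mono) auto
  also have "\<dots> = d" by (simp add: d_def algebra_simps)
  finally have le: "(2 * m - 1) / d \<le> 1 / (m + 1)"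
    using m d by (simp add: pos_divide_le_eq pos_le_divide_eq)
  have "\<bar>X0_coeff (Suc (Suc k))\<bar> = (2 * m - 1) / d * \<bar>X0_coeff (Suc k)\<bar>"
    using m d unfolding X0_coeff.simps m_def[symmetric] d_def[symmetric]
    by (simp add: abs_mult)
  also have "\<dots> \<le> 1 / (m + 1) * ((5 / 2) / fact (Suc k))"
    using m d 3 le by (intro mult_mono) auto
  also have "\<dots> = (5 / 2) / fact (Suc (Suc k))"
    by (simp add: m_def field_simps)
  finally show ?case .
qed auto

lemma summable_X0_coeff: "summable (\<lambda>k. X0_coeff k * t ^ k)"
proof (rule summable_comparison_test')
  show "summable (\<lambda>k. (5 / 2) * (\<bar>t\<bar> ^ k / fact k))"
    by (intro summable_mult) (use summable_exp[of "\<bar>t\<bar>"] in \<open>simp add: field_simps\<close>)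
  show "norm (X0_coeff k * t ^ k) \<le> (5 / 2) * (\<bar>t\<bar> ^ k / fact k)" for k
    using mult_right_mono[OF X0_coeff_bound[of k], of "\<bar>t\<bar> ^ k"]
    by (simp add: abs_mult power_abs)
qed

lemma summable_diffs_X0_coeff: "summable (\<lambda>k. diffs X0_coeff k * t ^ k)"
  by (rule termdiff_converges_all[OF summable_X0_coeff])

lemma summable_diffs2_X0_coeff: "summable (\<lambda>k. diffs (diffs X0_coeff) k * t ^ k)"
  by (rule termdiff_converges_all[OF summable_diffs_X0_coeff])

lemma DERIV_X0_sum: "(X0_sum has_real_derivative X0_sum1 t) (at t)"
  unfolding X0_sum_def[abs_def] X0_sum1_def
  by (rule termdiffs_strong_converges_everywhere[OF summable_X0_coeff])

lemma DERIV_X0_sum1: "(X0_sum1 has_real_derivative X0_sum2 t) (at t)"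
  unfolding X0_sum1_def[abs_def] X0_sum2_def
  by (rule termdiffs_strong_converges_everywhere[OF summable_diffs_X0_coeff])

lemma isCont_X0_sum2: "isCont X0_sum2 t"
  unfolding X0_sum2_def[abs_def]
  by (rule DERIV_isCont[OF termdiffs_strong_converges_everywhere[OF summable_diffs2_X0_coeff]])

section \<open>Differential equation, first integral and positivity of \<open>h_fun\<close>\<close>

text \<open>This is the operator \<open>t d/dt\<close> on power series, which multiplies the
  \<open>n\<close>-th coefficient by \<open>n\<close>. It lets the differential equation be compared
  coefficient by coefficient.\<close>

lemma sums_of_nat_mult_diffs:
  fixes c :: "nat \<Rightarrow> real"
  assumes "summable (\<lambda>n. diffs c n * t ^ n)"
  shows "(\<lambda>n. real n * c n * t ^ n) sums (t * (\<Sum>n. diffs c n * t ^ n))"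
proof -
  have "(\<lambda>n. t * (real n * c n * t ^ (n - Suc 0))) sums (t * (\<Sum>n. diffs c n * t ^ n))"
    by (rule sums_mult[OF diffs_equiv[OF assms]])
  also have "(\<lambda>n. t * (real n * c n * t ^ (n - Suc 0))) = (\<lambda>n. real n * c n * t ^ n)"
    by (rule ext, case_tac n) auto
  finally show ?thesis .
qed

text \<open>In the variable \<open>t = x\<^sup>2\<close>, the recurrence for the coefficients is the third-order equation
  \<open>8 t (t G'')' + (5/2 + 2 t) G' - G = 0\<close> for \<open>X\<^sub>0(x) = G(x\<^sup>2)\<close>.\<close>

lemma X0_sum_ode:
  assumes W: "((\<lambda>t. t * X0_sum2 t) has_real_derivative W) (at t)"
  shows "8 * t * W + (5 / 2 + 2 * t) * X0_sum1 t - X0_sum t = 0"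
proof -
  \<comment> \<open>\<open>e n\<close> is the \<open>n\<close>-th coefficient of
    \<open>t * X0_sum2 t\<close>, so \<open>t * W\<close> has the coefficients
    \<open>real n * e n\<close>.\<close>
  define e where "e n = real n * diffs X0_coeff n" for n
  have e_sums: "(\<lambda>n. e n * u ^ n) sums (u * X0_sum2 u)" for u
    using sums_of_nat_mult_diffs[OF summable_diffs2_X0_coeff] by (simp add: e_def X0_sum2_def)
  then have e_summable: "summable (\<lambda>n. e n * u ^ n)" for u
    by (rule sums_summable)
  have "((\<lambda>u. \<Sum>n. e n * u ^ n) has_real_derivative (\<Sum>n. diffs e n * t ^ n)) (at t)"
    by (rule termdiffs_strong_converges_everywhere[OF e_summable])
  moreover have "(\<lambda>u. \<Sum>n. e n * u ^ n) = (\<lambda>u. u * X0_sum2 u)"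
    using e_sums sums_unique by metis
  ultimately have "W = (\<Sum>n. diffs e n * t ^ n)"
    using W DERIV_unique by metis
  then have 1: "(\<lambda>n. real n * e n * t ^ n) sums (t * W)"
    using sums_of_nat_mult_diffs[OF termdiff_converges_all[OF e_summable]] by simp
  have 2: "(\<lambda>n. diffs X0_coeff n * t ^ n) sums X0_sum1 t"
    using summable_diffs_X0_coeff unfolding X0_sum1_def by (rule summable_sums)
  have 3: "(\<lambda>n. real n * X0_coeff n * t ^ n) sums (t * X0_sum1 t)"
    unfolding X0_sum1_def by (rule sums_of_nat_mult_diffs[OF summable_diffs_X0_coeff])
  have 4: "(\<lambda>n. X0_coeff n * t ^ n) sums X0_sum t"
    using summable_X0_coeff unfolding X0_sum_def by (rule summable_sums)
  have "(\<lambda>n. 8 * (real n * e n * t ^ n) + 5 / 2 * (diffs X0_coeff n * t ^ n)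
          + 2 * (real n * X0_coeff n * t ^ n) - X0_coeff n * t ^ n)
        sums (8 * (t * W) + 5 / 2 * X0_sum1 t + 2 * (t * X0_sum1 t) - X0_sum t)"
    by (intro sums_add sums_diff sums_mult 1 2 3 4)
  moreover have "8 * (real n * e n * t ^ n) + 5 / 2 * (diffs X0_coeff n * t ^ n)
          + 2 * (real n * X0_coeff n * t ^ n) - X0_coeff n * t ^ n = 0" for n
  proof -
    have "2 * (real n + 1) * (4 * (real n)\<^sup>2 + 5 / 4) * X0_coeff (n + 1)
         + (2 * real n - 1) * X0_coeff n = 0"
      \<comment> \<open>\<open>X0_coeff_recurrence\<close> starts at index 1; at
        \<open>n = 0\<close> the initial coefficients \<open>5 / 2\<close> and \<open>1\<close>
        satisfy the same relation.\<close>
      by (cases "n = 0") (simp, rule X0_coeff_recurrence, simp)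
    then have "(8 * (real n * e n) + 5 / 2 * diffs X0_coeff n
          + 2 * (real n * X0_coeff n) - X0_coeff n) * t ^ n = 0"
      by (simp add: e_def diffs_def algebra_simps power2_eq_square)
    then show ?thesis by (simp add: algebra_simps)
  qed
  ultimately have "8 * (t * W) + 5 / 2 * X0_sum1 t + 2 * (t * X0_sum1 t) - X0_sum t = 0"
    by (metis (no_types, lifting) sums_cong sums_zero sums_unique2)
  then show ?thesis by (simp add: algebra_simps)
qed

text \<open>The derivative of the left side is \<open>- 4 * X0_sum2 t\<close> times the left side of
  the differential equation, hence 0. The constant is the value at \<open>t = 0\<close>, where
  \<open>G = 5 / 2\<close> and \<open>G' = 1\<close>.\<close>

lemma X0_first_integral:
  "4 * X0_sum1 t * X0_sum t - 16 * (t * X0_sum2 t)\<^sup>2 - (5 + 4 * t) * (X0_sum1 t)\<^sup>2 = 5"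
proof -
  let ?I = "\<lambda>t. 4 * X0_sum1 t * X0_sum t - 16 * (t * X0_sum2 t)\<^sup>2 - (5 + 4 * t) * (X0_sum1 t)\<^sup>2"
  have "(?I has_real_derivative 0) (at u)" for u
  proof -
    have "(X0_sum2 has_real_derivative (\<Sum>k. diffs (diffs (diffs X0_coeff)) k * u ^ k)) (at u)"
      unfolding X0_sum2_def[abs_def]
      by (rule termdiffs_strong_converges_everywhere[OF summable_diffs2_X0_coeff])
    then obtain W where W: "((\<lambda>t. t * X0_sum2 t) has_real_derivative W) (at u)"
      using DERIV_mult[OF DERIV_ident] by blast
    have ode: "X0_sum u = 8 * u * W + (5 / 2 + 2 * u) * X0_sum1 u"
      using X0_sum_ode[OF W] by simp
    show ?thesis
      by (rule derivative_eq_intros DERIV_X0_sum DERIV_X0_sum1 W refl)+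
        (simp add: ode algebra_simps power2_eq_square)
  qed
  then have "?I t = ?I 0"
    by (intro DERIV_isconst_all allI)
  also have "?I 0 = 5"
    by (simp add: X0_sum_def X0_sum1_def diffs_def power2_eq_square)
  finally show ?thesis .
qed

text \<open>At a zero \<open>u\<close> of \<open>G'\<close> the first integral would read
  \<open>- 16 * (u * X0_sum2 u)^2 = 5\<close>. Since \<open>G'(0) = 1\<close>, a nonpositive value
  at \<open>t\<close> would force such a zero by the intermediate value theorem.\<close>

lemma X0_sum1_pos:
  assumes "t \<ge> 0"
  shows "X0_sum1 t > 0"
proof (rule ccontr)
  assume "\<not> X0_sum1 t > 0"
  moreover have "X0_sum1 0 > 0"
    by (simp add: X0_sum1_def diffs_def)
  moreover have "continuous_on {0..t} X0_sum1"
    by (intro continuous_at_imp_continuous_on ballI DERIV_isCont[OF DERIV_X0_sum1])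
  ultimately obtain u where "X0_sum1 u = 0"
    using IVT2'[of X0_sum1 t 0 0] assms by force
  then show False
    using X0_first_integral[of u] by (simp add: power2_eq_square) (smt (verit) zero_le_square)
qed

lemma X0_eq: "X0 x = X0_sum (x\<^sup>2)"
  by (simp add: X0_def X0_sum_def power_mult)

lemma deriv_X0: "deriv X0 x = 2 * x * X0_sum1 (x\<^sup>2)"
proof (rule DERIV_imp_deriv)
  show "(X0 has_real_derivative 2 * x * X0_sum1 (x\<^sup>2)) (at x)"
    unfolding X0_eq[abs_def]
    by (rule DERIV_cong[OF DERIV_chain2[OF DERIV_X0_sum]]) (auto intro!: derivative_eq_intros)
qed

lemma deriv2_X0: "deriv (deriv X0) x = 2 * X0_sum1 (x\<^sup>2) + 4 * x\<^sup>2 * X0_sum2 (x\<^sup>2)"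
proof (rule DERIV_imp_deriv)
  show "(deriv X0 has_real_derivative 2 * X0_sum1 (x\<^sup>2) + 4 * x\<^sup>2 * X0_sum2 (x\<^sup>2)) (at x)"
    unfolding deriv_X0[abs_def]
    by (rule derivative_eq_intros DERIV_chain2[OF DERIV_X0_sum1] refl)+ (simp add: power2_eq_square)
qed

text \<open>The first integral makes \<open>2 X\<^sub>0 - x X\<^sub>0'\<close> a sum of squares divided by \<open>X\<^sub>0'/x\<close>.\<close>

lemma h_fun_pos:
  assumes "x > 0"
  shows "h_fun x y > 0"
proof -
  define t where "t = x\<^sup>2"
  have G1: "X0_sum1 t > 0" by (rule X0_sum1_pos) (simp add: t_def)
  have "2 * X0_sum1 t * (2 * X0_sum t - 2 * t * X0_sum1 t)
      = 5 + 16 * (t * X0_sum2 t)\<^sup>2 + 5 * (X0_sum1 t)\<^sup>2"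
    using X0_first_integral[of t] by (simp add: algebra_simps power2_eq_square)
  also have "\<dots> > 0" by (intro add_pos_nonneg) auto
  finally have "2 * X0_sum t - 2 * t * X0_sum1 t > 0"
    using G1 by (simp add: zero_less_mult_iff)
  moreover have "h_fun x y = (2 * X0_sum t - 2 * t * X0_sum1 t) + 2 * y\<^sup>2 * X0_sum1 t + sqrt 5"
    using assms by (simp add: h_fun_def X0_eq deriv_X0 t_def power2_eq_square)
  ultimately show ?thesis using G1 by (simp add: add_pos_nonneg)
qed

section \<open>Continuity of the connection form on \<open>D\<close>\<close>

lemma continuous_on_X0_sums [continuous_intros]:
  assumes "continuous_on S f"
  shows "continuous_on S (\<lambda>z. X0_sum (f z))"
    and "continuous_on S (\<lambda>z. X0_sum1 (f z))"
    and "continuous_on S (\<lambda>z. X0_sum2 (f z))"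
proof -
  have "continuous_on UNIV X0_sum" "continuous_on UNIV X0_sum1" "continuous_on UNIV X0_sum2"
    using DERIV_isCont[OF DERIV_X0_sum] DERIV_isCont[OF DERIV_X0_sum1] isCont_X0_sum2
    by (simp_all add: continuous_at_imp_continuous_on)
  then show "continuous_on S (\<lambda>z. X0_sum (f z))" "continuous_on S (\<lambda>z. X0_sum1 (f z))"
    "continuous_on S (\<lambda>z. X0_sum2 (f z))"
    using assms by (auto intro: continuous_on_compose2)
qed

text \<open>\<open>X0\<close> and its derivatives are rewritten through the continuous series in
  \<open>x^2\<close>. The remaining denominators are \<open>x\<close>, \<open>2 * x\<close>,
  \<open>h_fun\<close> and \<open>x * h_fun\<close>, which have no zero on \<open>D\<close> by
  \<open>h_fun_pos\<close>.\<close>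

lemma continuous_on_connection_coeffs:
  assumes "S \<subseteq> right_half_plane"
  shows "continuous_on S (\<lambda>p. a1 (fst p) (snd p))"
    and "continuous_on S (\<lambda>p. b1 (fst p) (snd p))"
    and "continuous_on S (\<lambda>p. c1 (fst p) (snd p))"
    and "continuous_on S (\<lambda>p. a2 (fst p) (snd p))"
    and "continuous_on S (\<lambda>p. b2 (fst p) (snd p))"
    and "continuous_on S (\<lambda>p. c2 (fst p) (snd p))"
proof -
  have x: "fst p > 0" if "p \<in> S" for p
    using assms that by (auto simp: right_half_plane_def)
  then have x0: "\<forall>p\<in>S. fst p \<noteq> 0" by force
  have h0: "\<forall>p\<in>S. h_fun (fst p) (snd p) \<noteq> 0"
    using x h_fun_pos by (metis less_irrefl)
  have xh0: "\<forall>p\<in>S. fst p * h_fun (fst p) (snd p) \<noteq> 0"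
    using x0 h0 by simp
  have hc: "continuous_on S (\<lambda>p. h_fun (fst p) (snd p))"
    unfolding h_fun_def X0_eq deriv_X0 by (intro continuous_intros x0)
  note rules = continuous_intros hc x0 h0 xh0
  show "continuous_on S (\<lambda>p. a1 (fst p) (snd p))"
    unfolding a1_def X0_eq by (intro rules)
  show "continuous_on S (\<lambda>p. b1 (fst p) (snd p))"
    unfolding b1_def X0_eq by (intro rules)
  show "continuous_on S (\<lambda>p. c1 (fst p) (snd p))"
    unfolding c1_def X0_eq by (intro rules)
  show "continuous_on S (\<lambda>p. a2 (fst p) (snd p))"
    unfolding a2_def X0_eq deriv_X0 by (intro rules)
  have "\<forall>p\<in>S. 2 * fst p \<noteq> 0" using x0 by simp
  then show "continuous_on S (\<lambda>p. b2 (fst p) (snd p))"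
    unfolding b2_def deriv_X0 by (intro rules)
  show "continuous_on S (\<lambda>p. c2 (fst p) (snd p))"
    unfolding c2_def deriv_X0 deriv2_X0 by (intro rules)
qed

lemma vector_4 [simp]:
  "(vector [w, x, y, z] :: 'a::zero^4) $ 1 = w"
  "(vector [w, x, y, z] :: 'a::zero^4) $ 2 = x"
  "(vector [w, x, y, z] :: 'a::zero^4) $ 3 = y"
  "(vector [w, x, y, z] :: 'a::zero^4) $ 4 = z"
  unfolding vector_def by simp_all

lemma continuous_on_matrix_componentwise:
  fixes f :: "'a::topological_space \<Rightarrow> 'b::topological_space^'n^'m"
  assumes "\<And>i j. continuous_on S (\<lambda>p. f p $ i $ j)"
  shows "continuous_on S f"
proof -
  have "continuous_on S (\<lambda>p. \<chi> i j. f p $ i $ j)"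
    by (intro continuous_on_vec_lambda assms)
  then show ?thesis by (simp add: vec_nth_inverse)
qed

lemma continuous_on_Omega:
  assumes "S \<subseteq> right_half_plane"
  shows "continuous_on S (\<lambda>p. Omega1 (fst p) (snd p))"
    and "continuous_on S (\<lambda>p. Omega2 (fst p) (snd p))"
proof -
  note coeffs = continuous_on_connection_coeffs[OF assms]
  have "\<forall>i j. continuous_on S (\<lambda>p. Omega1 (fst p) (snd p) $ i $ j)"
    unfolding forall_4 Omega1_def by (simp add: continuous_on_minus coeffs)
  then show "continuous_on S (\<lambda>p. Omega1 (fst p) (snd p))"
    by (intro continuous_on_matrix_componentwise) blast
  have "\<forall>i j. continuous_on S (\<lambda>p. Omega2 (fst p) (snd p) $ i $ j)"
    unfolding forall_4 Omega2_def by (simp add: continuous_on_minus coeffs)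
  then show "continuous_on S (\<lambda>p. Omega2 (fst p) (snd p))"
    by (intro continuous_on_matrix_componentwise) blast
qed

section \<open>Convergence of one-step methods\<close>

text \<open>Bilinear maps in finite dimension are bounded, so only linearity in each argument has to
  be checked. This makes the matrix product an instance of \<open>mult\<close> in
  \<open>one_step_convergence\<close>.\<close>

lemma bounded_bilinear_matrix_matrix_mult:
  "bounded_bilinear ((**) :: real^'n^'m \<Rightarrow> real^'k^'n \<Rightarrow> real^'k^'m)"
  unfolding bilinear_conv_bounded_bilinear[symmetric] bilinear_def
  by (auto intro!: linearI simp: matrix_add_ldistrib matrix_scalar_ac
      scalar_matrix_assoc[symmetric]) (vector matrix_matrix_mult_def sum.distrib[symmetric] field_simps)

text \<open>Every local error \<open>d\<close> is charged the full amplification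
  \<open>(1 + c) ^ m\<close> instead of a geometric sum. When \<open>c\<close> and \<open>d\<close>
  are proportional to the step length, the bound still depends only on the total length of the
  \<open>m\<close> steps.\<close>

lemma discrete_gronwall:
  fixes e :: "nat \<Rightarrow> real"
  assumes "\<And>i. i < m \<Longrightarrow> e (Suc i) \<le> (1 + c) * e i + d" and "0 \<le> c" "0 \<le> d" and "0 \<le> e 0"
  shows "e m \<le> (1 + c) ^ m * (e 0 + real m * d)"
  using assms(1)
proof (induction m)
  case (Suc m)
  have "e (Suc m) \<le> (1 + c) * e m + d" using Suc.prems by simp
  also have "\<dots> \<le> (1 + c) * ((1 + c) ^ m * (e 0 + real m * d)) + (1 + c) ^ Suc m * d"
  proof (intro add_mono mult_left_mono)
    show "e m \<le> (1 + c) ^ m * (e 0 + real m * d)" using Suc by simp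
    have "1 * d \<le> (1 + c) ^ Suc m * d"
      using assms by (intro mult_right_mono one_le_power) auto
    then show "d \<le> (1 + c) ^ Suc m * d" by simp
  qed (use assms in auto)
  also have "\<dots> = (1 + c) ^ Suc m * (e 0 + real (Suc m) * d)"
    by (simp add: algebra_simps)
  finally show ?case .
qed simp

text \<open>Uniform consistency of a one-step scheme with increment function \<open>\<Psi>\<close>. Comparing
  \<open>F' = \<Psi>(\<cdot>, 0)\<close> along the edge with the constant \<open>\<Psi> (z, \<tau>)\<close> only uses that \<open>\<Psi>\<close> is uniformly
  continuous, so no second derivatives of \<open>F\<close> are needed.\<close>

lemma one_step_defect:
  fixes F :: "'a::real_normed_vector \<Rightarrow> 'b::real_normed_vector" and \<Psi> :: "'a \<times> real \<Rightarrow> 'b"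
  assumes E: "compact E" "convex E" and v: "norm v = 1"
    and \<Psi>: "continuous_on (E \<times> {0..a}) \<Psi>"
    and F: "\<And>z. z \<in> E \<Longrightarrow> (F has_derivative F' z) (at z within E)"
    and F': "\<And>z. z \<in> E \<Longrightarrow> F' z v = \<Psi> (z, 0)"
    and \<epsilon>: "\<epsilon> > 0"
  obtains \<delta> where "\<delta> > 0"
    and "\<And>z \<tau>. z \<in> E \<Longrightarrow> z + \<tau> *\<^sub>R v \<in> E \<Longrightarrow> 0 \<le> \<tau> \<Longrightarrow> \<tau> \<le> a \<Longrightarrow> \<tau> \<le> \<delta> \<Longrightarrow>
          norm (F (z + \<tau> *\<^sub>R v) - F z - \<tau> *\<^sub>R \<Psi> (z, \<tau>)) \<le> \<epsilon> * \<tau>"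
proof -
  have "uniformly_continuous_on (E \<times> {0..a}) \<Psi>"
    using \<Psi> E by (intro compact_uniformly_continuous compact_Times) auto
  then obtain \<delta> where \<delta>: "\<delta> > 0" and close:
    "\<And>p q. p \<in> E \<times> {0..a} \<Longrightarrow> q \<in> E \<times> {0..a} \<Longrightarrow> dist p q < \<delta> \<Longrightarrow> dist (\<Psi> p) (\<Psi> q) < \<epsilon>"
    using \<epsilon> unfolding uniformly_continuous_on_def by metis
  \<comment> \<open>The two arguments of \<open>\<Psi>\<close> to be compared have distance at most
    \<open>\<sigma> + \<tau>\<close>; a third of \<open>\<delta>\<close> keeps this strictly below
    \<open>\<delta>\<close>.\<close>
  show ?thesis
  proof (rule that[of "\<delta> / 3"])
    show "\<delta> / 3 > 0" using \<delta> by simp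
    fix z \<tau> assume z: "z \<in> E" "z + \<tau> *\<^sub>R v \<in> E" and \<tau>: "0 \<le> \<tau>" "\<tau> \<le> a" "\<tau> \<le> \<delta> / 3"
    \<comment> \<open>Subtracting the linear motion with the slope of the scheme turns the defect
      into \<open>g \<tau> - g 0\<close>. The derivative of \<open>g\<close> at
      \<open>\<sigma>\<close> is
      \<open>\<Psi> (z + \<sigma> *\<^sub>R v, 0) - \<Psi> (z, \<tau>)\<close>, so the mean value
      inequality applies.\<close>
    define g where "g \<sigma> = F (z + \<sigma> *\<^sub>R v) - \<sigma> *\<^sub>R \<Psi> (z, \<tau>)" for \<sigma>
    have seg: "z + \<sigma> *\<^sub>R v \<in> E" if "\<sigma> \<in> {0..\<tau>}" for \<sigma>
    proof (cases "\<tau> = 0")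
      case False
      then have "(1 - \<sigma> / \<tau>) *\<^sub>R z + (\<sigma> / \<tau>) *\<^sub>R (z + \<tau> *\<^sub>R v) \<in> E"
        using that \<tau> by (intro convexD[OF E(2) z]) auto
      also have "(1 - \<sigma> / \<tau>) *\<^sub>R z + (\<sigma> / \<tau>) *\<^sub>R (z + \<tau> *\<^sub>R v) = z + \<sigma> *\<^sub>R v"
        using False by (simp add: algebra_simps)
      finally show ?thesis .
    qed (use that z in auto)
    have "norm (g \<tau> - g 0) \<le> \<epsilon> * norm (\<tau> - 0)"
    proof (rule differentiable_bound)
      fix \<sigma> assume \<sigma>: "\<sigma> \<in> {0..\<tau>}"
      have "((\<lambda>\<sigma>. F (z + \<sigma> *\<^sub>R v)) has_derivative (\<lambda>h. F' (z + \<sigma> *\<^sub>R v) (h *\<^sub>R v))) (at \<sigma> within {0..\<tau>})"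
        by (rule has_derivative_in_compose2[where t = E and g' = F'])
          (use F seg \<sigma> in \<open>auto intro!: derivative_eq_intros\<close>)
      then show "(g has_derivative (\<lambda>h. F' (z + \<sigma> *\<^sub>R v) (h *\<^sub>R v) - h *\<^sub>R \<Psi> (z, \<tau>))) (at \<sigma> within {0..\<tau>})"
        unfolding g_def[abs_def] by (auto intro!: derivative_eq_intros)
      show "onorm (\<lambda>h. F' (z + \<sigma> *\<^sub>R v) (h *\<^sub>R v) - h *\<^sub>R \<Psi> (z, \<tau>)) \<le> \<epsilon>"
      proof (rule onorm_le)
        fix h :: real
        have "F' (z + \<sigma> *\<^sub>R v) (h *\<^sub>R v) - h *\<^sub>R \<Psi> (z, \<tau>)
            = h *\<^sub>R (\<Psi> (z + \<sigma> *\<^sub>R v, 0) - \<Psi> (z, \<tau>))"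
          using F'[OF seg[OF \<sigma>]] linear_cmul[OF has_derivative_linear[OF F[OF seg[OF \<sigma>]]]]
          by (simp add: algebra_simps)
        moreover have "dist (\<Psi> (z + \<sigma> *\<^sub>R v, 0)) (\<Psi> (z, \<tau>)) < \<epsilon>"
        proof (rule close)
          have "dist (z + \<sigma> *\<^sub>R v, 0::real) (z, \<tau>) \<le> dist (z + \<sigma> *\<^sub>R v) z + dist 0 \<tau>"
            unfolding dist_Pair_Pair by (rule sqrt_sum_squares_le_sum) auto
          also have "\<dots> = \<sigma> + \<tau>" using \<sigma> \<tau> v by (simp add: dist_norm)
          also have "\<dots> < \<delta>" using \<sigma> \<tau> \<delta> by auto
          finally show "dist (z + \<sigma> *\<^sub>R v, 0::real) (z, \<tau>) < \<delta>" .
        qed (use seg \<sigma> z \<tau> in auto)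
        ultimately show "norm (F' (z + \<sigma> *\<^sub>R v) (h *\<^sub>R v) - h *\<^sub>R \<Psi> (z, \<tau>)) \<le> \<epsilon> * norm h"
          by (simp add: dist_norm mult.commute[of \<epsilon>] mult_left_mono)
      qed
    qed (use \<tau> in auto)
    then show "norm (F (z + \<tau> *\<^sub>R v) - F z - \<tau> *\<^sub>R \<Psi> (z, \<tau>)) \<le> \<epsilon> * \<tau>"
      using \<tau> by (simp add: g_def algebra_simps)
  qed
qed

lemma one_step_convergence:
  fixes mult :: "'b::real_normed_vector \<Rightarrow> 'c::real_normed_vector \<Rightarrow> 'b"
    and F :: "'a::real_normed_vector \<Rightarrow> 'b" and N :: "'a \<times> real \<Rightarrow> 'c"
  assumes mult: "bounded_bilinear mult"
    and E: "compact E" "convex E" and v: "norm v = 1" and a: "a \<ge> 0"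
    and N: "continuous_on (E \<times> {0..a}) N"
    and F: "\<And>z. z \<in> E \<Longrightarrow> (F has_derivative F' z) (at z within E)"
    and F': "\<And>z. z \<in> E \<Longrightarrow> F' z v = mult (F z) (N (z, 0))"
  obtains C where "C \<ge> 0"
    and "\<And>\<eta>. \<eta> > 0 \<Longrightarrow> \<exists>\<delta>>0. \<forall>z l m u. z \<in> E \<longrightarrow> z + l *\<^sub>R v \<in> E \<longrightarrow> 0 \<le> l \<longrightarrow> l \<le> a \<longrightarrow> 0 < m \<longrightarrow>
          l / real m \<le> \<delta> \<longrightarrow>
          (\<forall>i<m. u (Suc i) = u i + (l / real m) *\<^sub>R
             mult (u i) (N (z + (real i * (l / real m)) *\<^sub>R v, l / real m))) \<longrightarrow>
          norm (u m - F (z + l *\<^sub>R v)) \<le> C * norm (u 0 - F z) + \<eta>"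
proof -
  interpret mult: bounded_bilinear mult by (rule mult)
  obtain K where K: "K \<ge> 0" "\<And>x y. norm (mult x y) \<le> norm x * norm y * K"
    using mult.nonneg_bounded by blast
  have "bounded (N ` (E \<times> {0..a}))"
    using N E by (intro compact_imp_bounded compact_continuous_image compact_Times) auto
  then obtain B where B: "B > 0" "\<And>p. p \<in> E \<times> {0..a} \<Longrightarrow> norm (N p) \<le> B"
    unfolding bounded_pos by blast
  \<comment> \<open>\<open>L\<close> bounds the maps \<open>\<lambda>x. mult x (N p)\<close>
    uniformly in \<open>p\<close>, so one step amplifies an error by at most
    \<open>1 + L * \<tau>\<close>.\<close>
  define L where "L = B * K"
  have L: "L \<ge> 0" using B K by (simp add: L_def)
  have multL: "norm (mult x (N p)) \<le> L * norm x" if "p \<in> E \<times> {0..a}" for x p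
  proof -
    have "norm (mult x (N p)) \<le> norm x * norm (N p) * K" by (rule K)
    also have "\<dots> \<le> norm x * B * K"
      using K B(2)[OF that] by (intro mult_right_mono mult_left_mono) auto
    finally show ?thesis by (simp add: L_def mult_ac)
  qed
  \<comment> \<open>Bound for the total amplification:
    \<open>(1 + L * \<tau>) ^ m \<le> exp (L * l)\<close> and \<open>l \<le> a\<close>.\<close>
  define C where "C = exp (L * a)"
  have "continuous_on E F"
    using F has_derivative_continuous_on by blast
  then have \<Psi>: "continuous_on (E \<times> {0..a}) (\<lambda>p. mult (F (fst p)) (N p))"
    by (intro mult.continuous_on N) (auto intro!: continuous_on_compose2[of E F] continuous_intros)
  show ?thesis
  proof (rule that[of C])
    show "C \<ge> 0" by (simp add: C_def)
    fix \<eta> :: real assume \<eta>: "\<eta> > 0"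
    \<comment> \<open>The local errors add up to at most \<open>C * (a * \<epsilon>)\<close>;
      \<open>a + 1\<close> keeps the denominator positive for \<open>a = 0\<close>.\<close>
    define \<epsilon> where "\<epsilon> = \<eta> / (C * (a + 1))"
    have C: "C > 0" by (simp add: C_def)
    have \<epsilon>: "\<epsilon> > 0" using \<eta> a C by (simp add: \<epsilon>_def)
    have \<epsilon>\<eta>: "C * (a * \<epsilon>) \<le> \<eta>"
      using \<eta> a C by (simp add: \<epsilon>_def pos_divide_le_eq)
    obtain \<delta> where \<delta>: "\<delta> > 0" and defect:
      "\<And>z \<tau>. z \<in> E \<Longrightarrow> z + \<tau> *\<^sub>R v \<in> E \<Longrightarrow> 0 \<le> \<tau> \<Longrightarrow> \<tau> \<le> a \<Longrightarrow> \<tau> \<le> \<delta> \<Longrightarrow>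
          norm (F (z + \<tau> *\<^sub>R v) - F z - \<tau> *\<^sub>R mult (F z) (N (z, \<tau>))) \<le> \<epsilon> * \<tau>"
      by (rule one_step_defect[OF E v \<Psi> F _ \<epsilon>]) (auto simp: F')
    show "\<exists>\<delta>>0. \<forall>z l m u. z \<in> E \<longrightarrow> z + l *\<^sub>R v \<in> E \<longrightarrow> 0 \<le> l \<longrightarrow> l \<le> a \<longrightarrow> 0 < m \<longrightarrow>
          l / real m \<le> \<delta> \<longrightarrow>
          (\<forall>i<m. u (Suc i) = u i + (l / real m) *\<^sub>R
             mult (u i) (N (z + (real i * (l / real m)) *\<^sub>R v, l / real m))) \<longrightarrow>
          norm (u m - F (z + l *\<^sub>R v)) \<le> C * norm (u 0 - F z) + \<eta>"
    proof (intro exI[of _ \<delta>] conjI \<delta> allI impI)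
      fix z l and m :: nat and u
      assume z: "z \<in> E" "z + l *\<^sub>R v \<in> E" and l: "0 \<le> l" "l \<le> a" and m: "0 < m"
        and \<tau>\<delta>: "l / real m \<le> \<delta>"
        and u: "\<forall>i<m. u (Suc i) = u i + (l / real m) *\<^sub>R
             mult (u i) (N (z + (real i * (l / real m)) *\<^sub>R v, l / real m))"
      define \<tau> where "\<tau> = l / real m"
      have m\<tau>: "real m * \<tau> = l" using m by (simp add: \<tau>_def)
      have \<tau>0: "0 \<le> \<tau>" using l by (simp add: \<tau>_def)
      have \<tau>a: "\<tau> \<le> a"
      proof -
        have "l \<le> a * 1" using l by simp
        also have "\<dots> \<le> a * real m" using m a by (intro mult_left_mono) auto
        finally show ?thesis using m by (simp add: \<tau>_def divide_le_eq)
      qed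
      define w where "w i = z + (real i * \<tau>) *\<^sub>R v" for i :: nat
      have w: "w i \<in> E" if "i \<le> m" for i
      proof -
        have "(1 - real i / real m) *\<^sub>R z + (real i / real m) *\<^sub>R (z + l *\<^sub>R v) \<in> E"
          using that m by (intro convexD[OF E(2) z]) auto
        also have "(1 - real i / real m) *\<^sub>R z + (real i / real m) *\<^sub>R (z + l *\<^sub>R v) = w i"
          by (simp add: w_def \<tau>_def algebra_simps)
        finally show ?thesis .
      qed
      have w_Suc: "w (Suc i) = w i + \<tau> *\<^sub>R v" for i
        by (simp add: w_def algebra_simps)
      define e where "e i = norm (u i - F (w i))" for i
      have "e (Suc i) \<le> (1 + L * \<tau>) * e i + \<epsilon> * \<tau>" if i: "i < m" for i
      proof -
        have wi: "w i \<in> E" "w i + \<tau> *\<^sub>R v \<in> E"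
          using w[of i] w[of "Suc i"] i by (auto simp: w_Suc)
        have "u (Suc i) = u i + \<tau> *\<^sub>R mult (u i) (N (w i, \<tau>))"
          using u i by (simp add: w_def \<tau>_def)
        \<comment> \<open>The new error is the old error carried through one step of the scheme,
          minus the defect of the exact solution.\<close>
        then have "u (Suc i) - F (w (Suc i)) =
            (u i - F (w i)) + \<tau> *\<^sub>R mult (u i - F (w i)) (N (w i, \<tau>))
            - (F (w i + \<tau> *\<^sub>R v) - F (w i) - \<tau> *\<^sub>R mult (F (w i)) (N (w i, \<tau>)))"
          by (simp add: w_Suc mult.diff_left scaleR_diff_right)
        then have "e (Suc i) \<le> norm (u i - F (w i)) + norm (\<tau> *\<^sub>R mult (u i - F (w i)) (N (w i, \<tau>)))
            + norm (F (w i + \<tau> *\<^sub>R v) - F (w i) - \<tau> *\<^sub>R mult (F (w i)) (N (w i, \<tau>)))"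
          unfolding e_def by (metis norm_triangle_le_diff add_mono norm_triangle_ineq order_refl)
        also have "\<dots> \<le> e i + \<tau> * (L * e i) + \<epsilon> * \<tau>"
        proof (intro add_mono)
          show "norm (\<tau> *\<^sub>R mult (u i - F (w i)) (N (w i, \<tau>))) \<le> \<tau> * (L * e i)"
            using multL[of "(w i, \<tau>)"] wi \<tau>0 \<tau>a by (simp add: e_def mult_left_mono)
          show "norm (F (w i + \<tau> *\<^sub>R v) - F (w i) - \<tau> *\<^sub>R mult (F (w i)) (N (w i, \<tau>))) \<le> \<epsilon> * \<tau>"
            using defect[OF wi \<tau>0 \<tau>a] \<tau>\<delta> by (simp add: \<tau>_def)
        qed (simp add: e_def)
        finally show ?thesis by (simp add: algebra_simps)
      qed
      then have "e m \<le> (1 + L * \<tau>) ^ m * (e 0 + real m * (\<epsilon> * \<tau>))"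
        using L \<tau>0 \<epsilon> by (intro discrete_gronwall) (auto simp: e_def)
      also have "\<dots> \<le> C * (e 0 + a * \<epsilon>)"
      proof (rule mult_mono)
        have "(1 + L * \<tau>) ^ m \<le> exp (L * \<tau>) ^ m"
          using L \<tau>0 by (intro power_mono exp_ge_add_one_self) auto
        also have "\<dots> = exp (L * l)"
          using m\<tau> by (simp add: exp_of_nat_mult[symmetric] mult.left_commute)
        also have "\<dots> \<le> C" using L l by (simp add: C_def mult_left_mono)
        finally show "(1 + L * \<tau>) ^ m \<le> C" .
        have "real m * (\<epsilon> * \<tau>) = l * \<epsilon>" using m\<tau> by (metis mult.assoc mult.commute)
        then show "e 0 + real m * (\<epsilon> * \<tau>) \<le> e 0 + a * \<epsilon>" using l \<epsilon> by simp
      qed (use C \<epsilon> \<tau>0 in \<open>auto simp: e_def\<close>)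
      also have "\<dots> \<le> C * e 0 + \<eta>" using \<epsilon>\<eta> by (simp add: algebra_simps)
      finally show "norm (u m - F (z + l *\<^sub>R v)) \<le> C * norm (u 0 - F z) + \<eta>"
        by (simp add: e_def w_def m\<tau>)
    qed
  qed
qed

section \<open>The stepping scheme along horizontal and vertical segments\<close>

text \<open>The factor of \<open>F\<close> in the stepping scheme is \<open>Id + \<tau> N\<close> with \<open>N\<close> depending continuously on
  the lattice point and the step size \<open>\<tau>\<close>, and \<open>N = \<Omega>\<^sub>i\<close> for \<open>\<tau> = 0\<close>. Here \<open>r\<close> stands for \<open>a\<^sub>i\<^sup>2 + b\<^sub>i\<^sup>2 + c\<^sub>i\<^sup>2\<close>.\<close>

definition step_increment :: "real \<Rightarrow> real^4^4 \<Rightarrow> real \<Rightarrow> real^4^4" where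
  "step_increment r A \<tau> = (4 / (4 + \<tau>\<^sup>2 * r)) *\<^sub>R (A + (\<tau> / 2) *\<^sub>R (A ** A))"

lemma step_increment_0 [simp]: "step_increment r A 0 = A"
  by (simp add: step_increment_def)

lemma continuous_on_step_increment:
  assumes "continuous_on S r" "continuous_on S A" "\<And>p. p \<in> S \<Longrightarrow> r p \<ge> 0"
  shows "continuous_on (S \<times> T) (\<lambda>q. step_increment (r (fst q)) (A (fst q)) (snd q))"
proof -
  \<comment> \<open>Nonnegativity of \<open>r\<close> keeps the denominator at least 4.\<close>
  have nz: "\<forall>q\<in>S \<times> T. 4 + (snd q)\<^sup>2 * r (fst q) \<noteq> 0"
    using assms(3) by (auto simp: add_pos_nonneg less_imp_neq[symmetric])
  have r: "continuous_on (S \<times> T) (\<lambda>q. r (fst q))" and A: "continuous_on (S \<times> T) (\<lambda>q. A (fst q))"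
    using assms by (auto intro!: continuous_on_compose2[of S] continuous_intros)
  show ?thesis
    unfolding step_increment_def
    by (intro continuous_intros bounded_bilinear.continuous_on[OF bounded_bilinear_matrix_matrix_mult]
        r A nz) auto
qed

text \<open>Brings \<open>horizontal_step\<close> and \<open>vertical_step\<close> into the additive
  form demanded by \<open>one_step_convergence\<close>.\<close>

lemma matrix_mult_step:
  fixes F :: "real^4^4"
  shows "F ** (mat 1 + (\<tau> * (4 / (4 + \<tau>\<^sup>2 * r))) *\<^sub>R (A + (\<tau> / 2) *\<^sub>R (A ** A)))
       = F + \<tau> *\<^sub>R (F ** step_increment r A \<tau>)"
  by (simp add: step_increment_def matrix_add_ldistrib matrix_scalar_ac
      scalar_matrix_assoc[symmetric] scaleR_add_right mult.left_commute del: times_divide_eq_right)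

lemma division_point_Suc_diff:
  "division_point u v m (Suc i) - division_point u v m i = (v - u) / real m"
  by (simp add: division_point_def distrib_right del: times_divide_eq_right)

text \<open>In the direction \<open>(1, 0)\<close> the form \<open>Omega\<close> reduces to
  \<open>Omega1\<close>, and \<open>one_step_convergence\<close> applies. The start frame
  \<open>F\<close> and the height \<open>y\<close> stay arbitrary because the segment is the first
  leg of the lower path but the second leg of the upper one.\<close>

lemma horizontal_path_convergence:
  assumes E: "compact E" "convex E" "E \<subseteq> right_half_plane" and "frame_field F0" and "a \<ge> 0"
  shows "\<exists>C\<ge>0. \<forall>\<eta>>0. \<exists>\<delta>>0. \<forall>x x' y m F. (x, y) \<in> E \<longrightarrow> (x', y) \<in> E \<longrightarrow> x \<le> x' \<longrightarrow> x' \<le> x + a \<longrightarrow>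
          0 < m \<longrightarrow> (x' - x) / real m \<le> \<delta> \<longrightarrow>
          norm (horizontal_path x x' m y F m - F0 (x', y)) \<le> C * norm (F - F0 (x, y)) + \<eta>"
proof -
  define r where "r p = (a1 (fst p) (snd p))\<^sup>2 + (b1 (fst p) (snd p))\<^sup>2 + (c1 (fst p) (snd p))\<^sup>2" for p
  define N where "N q = step_increment (r (fst q)) (Omega1 (fst (fst q)) (snd (fst q))) (snd q)" for q
  have r: "continuous_on E r"
    unfolding r_def by (intro continuous_intros continuous_on_connection_coeffs E)
  have N: "continuous_on (E \<times> {0..a}) N"
    unfolding N_def by (rule continuous_on_step_increment[OF r continuous_on_Omega(1)[OF E(3)]])
      (simp add: r_def)
  have F0: "(F0 has_derivative (\<lambda>v. F0 z ** Omega z v)) (at z within E)" if "z \<in> E" for z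
    using assms that by (auto simp: frame_field_def intro: has_derivative_at_withinI)
  obtain C where C: "C \<ge> 0" and conv:
    "\<And>\<eta>. \<eta> > 0 \<Longrightarrow> \<exists>\<delta>>0. \<forall>z l m u. z \<in> E \<longrightarrow> z + l *\<^sub>R (1, 0) \<in> E \<longrightarrow> 0 \<le> l \<longrightarrow> l \<le> a \<longrightarrow> 0 < m \<longrightarrow>
          l / real m \<le> \<delta> \<longrightarrow>
          (\<forall>i<m. u (Suc i) = u i + (l / real m) *\<^sub>R
             (u i ** N (z + (real i * (l / real m)) *\<^sub>R (1, 0), l / real m))) \<longrightarrow>
          norm (u m - F0 (z + l *\<^sub>R (1, 0))) \<le> C * norm (u 0 - F0 z) + \<eta>"
    by (rule one_step_convergence[OF bounded_bilinear_matrix_matrix_mult E(1,2) _ \<open>a \<ge> 0\<close> N F0,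
          where v = "(1, 0)"]) (auto simp: N_def Omega_def norm_Pair)
  show ?thesis
  proof (rule exI[of _ C], intro conjI C allI impI)
    fix \<eta> :: real assume "\<eta> > 0"
    from conv[OF this] obtain \<delta> where "\<delta> > 0" and \<delta>:
      "\<And>z l m u. z \<in> E \<Longrightarrow> z + l *\<^sub>R (1, 0) \<in> E \<Longrightarrow> 0 \<le> l \<Longrightarrow> l \<le> a \<Longrightarrow> 0 < m \<Longrightarrow>
          l / real m \<le> \<delta> \<Longrightarrow>
          (\<forall>i<m. u (Suc i) = u i + (l / real m) *\<^sub>R
             (u i ** N (z + (real i * (l / real m)) *\<^sub>R (1, 0), l / real m))) \<Longrightarrow>
          norm (u m - F0 (z + l *\<^sub>R (1, 0))) \<le> C * norm (u 0 - F0 z) + \<eta>"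
      by metis
    show "\<exists>\<delta>>0. \<forall>x x' y m F. (x, y) \<in> E \<longrightarrow> (x', y) \<in> E \<longrightarrow> x \<le> x' \<longrightarrow> x' \<le> x + a \<longrightarrow>
          0 < m \<longrightarrow> (x' - x) / real m \<le> \<delta> \<longrightarrow>
          norm (horizontal_path x x' m y F m - F0 (x', y)) \<le> C * norm (F - F0 (x, y)) + \<eta>"
    proof (intro exI[of _ \<delta>] conjI \<open>\<delta> > 0\<close> allI impI)
      fix x x' y :: real and m :: nat and F :: "real^4^4"
      assume *: "(x, y) \<in> E" "(x', y) \<in> E" "x \<le> x'" "x' \<le> x + a" "0 < m" "(x' - x) / real m \<le> \<delta>"
      define \<tau> where "\<tau> = (x' - x) / real m"
      have "horizontal_path x x' m y F (Suc i) = horizontal_path x x' m y F i +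
          \<tau> *\<^sub>R (horizontal_path x x' m y F i ** N ((x, y) + (real i * \<tau>) *\<^sub>R (1, 0), \<tau>))" for i
      proof -
        have "division_point x x' m (Suc i) - division_point x x' m i = \<tau>"
          by (simp add: division_point_Suc_diff \<tau>_def)
        then show ?thesis
          by (simp add: horizontal_step_def Let_def N_def r_def matrix_mult_step
              del: times_divide_eq_right)
            (simp add: division_point_def \<tau>_def)
      qed
      then show "norm (horizontal_path x x' m y F m - F0 (x', y)) \<le> C * norm (F - F0 (x, y)) + \<eta>"
        using \<delta>[of "(x, y)" "x' - x" m "horizontal_path x x' m y F"] * by (simp add: \<tau>_def)
    qed
  qed
qed

text \<open>The same argument in the direction \<open>(0, 1)\<close>, where \<open>Omega\<close>
  reduces to \<open>Omega2\<close>.\<close>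

lemma vertical_path_convergence:
  assumes E: "compact E" "convex E" "E \<subseteq> right_half_plane" and "frame_field F0" and "a \<ge> 0"
  shows "\<exists>C\<ge>0. \<forall>\<eta>>0. \<exists>\<delta>>0. \<forall>x y y' m F. (x, y) \<in> E \<longrightarrow> (x, y') \<in> E \<longrightarrow> y \<le> y' \<longrightarrow> y' \<le> y + a \<longrightarrow>
          0 < m \<longrightarrow> (y' - y) / real m \<le> \<delta> \<longrightarrow>
          norm (vertical_path y y' m x F m - F0 (x, y')) \<le> C * norm (F - F0 (x, y)) + \<eta>"
proof -
  define r where "r p = (a2 (fst p) (snd p))\<^sup>2 + (b2 (fst p) (snd p))\<^sup>2 + (c2 (fst p) (snd p))\<^sup>2" for p
  define N where "N q = step_increment (r (fst q)) (Omega2 (fst (fst q)) (snd (fst q))) (snd q)" for q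
  have r: "continuous_on E r"
    unfolding r_def by (intro continuous_intros continuous_on_connection_coeffs E)
  have N: "continuous_on (E \<times> {0..a}) N"
    unfolding N_def by (rule continuous_on_step_increment[OF r continuous_on_Omega(2)[OF E(3)]])
      (simp add: r_def)
  have F0: "(F0 has_derivative (\<lambda>v. F0 z ** Omega z v)) (at z within E)" if "z \<in> E" for z
    using assms that by (auto simp: frame_field_def intro: has_derivative_at_withinI)
  obtain C where C: "C \<ge> 0" and conv:
    "\<And>\<eta>. \<eta> > 0 \<Longrightarrow> \<exists>\<delta>>0. \<forall>z l m u. z \<in> E \<longrightarrow> z + l *\<^sub>R (0, 1) \<in> E \<longrightarrow> 0 \<le> l \<longrightarrow> l \<le> a \<longrightarrow> 0 < m \<longrightarrow>
          l / real m \<le> \<delta> \<longrightarrow>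
          (\<forall>i<m. u (Suc i) = u i + (l / real m) *\<^sub>R
             (u i ** N (z + (real i * (l / real m)) *\<^sub>R (0, 1), l / real m))) \<longrightarrow>
          norm (u m - F0 (z + l *\<^sub>R (0, 1))) \<le> C * norm (u 0 - F0 z) + \<eta>"
    by (rule one_step_convergence[OF bounded_bilinear_matrix_matrix_mult E(1,2) _ \<open>a \<ge> 0\<close> N F0,
          where v = "(0, 1)"]) (auto simp: N_def Omega_def norm_Pair)
  show ?thesis
  proof (rule exI[of _ C], intro conjI C allI impI)
    fix \<eta> :: real assume "\<eta> > 0"
    from conv[OF this] obtain \<delta> where "\<delta> > 0" and \<delta>:
      "\<And>z l m u. z \<in> E \<Longrightarrow> z + l *\<^sub>R (0, 1) \<in> E \<Longrightarrow> 0 \<le> l \<Longrightarrow> l \<le> a \<Longrightarrow> 0 < m \<Longrightarrow>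
          l / real m \<le> \<delta> \<Longrightarrow>
          (\<forall>i<m. u (Suc i) = u i + (l / real m) *\<^sub>R
             (u i ** N (z + (real i * (l / real m)) *\<^sub>R (0, 1), l / real m))) \<Longrightarrow>
          norm (u m - F0 (z + l *\<^sub>R (0, 1))) \<le> C * norm (u 0 - F0 z) + \<eta>"
      by metis
    show "\<exists>\<delta>>0. \<forall>x y y' m F. (x, y) \<in> E \<longrightarrow> (x, y') \<in> E \<longrightarrow> y \<le> y' \<longrightarrow> y' \<le> y + a \<longrightarrow>
          0 < m \<longrightarrow> (y' - y) / real m \<le> \<delta> \<longrightarrow>
          norm (vertical_path y y' m x F m - F0 (x, y')) \<le> C * norm (F - F0 (x, y)) + \<eta>"
    proof (intro exI[of _ \<delta>] conjI \<open>\<delta> > 0\<close> allI impI)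
      fix x y y' :: real and m :: nat and F :: "real^4^4"
      assume *: "(x, y) \<in> E" "(x, y') \<in> E" "y \<le> y'" "y' \<le> y + a" "0 < m" "(y' - y) / real m \<le> \<delta>"
      define \<tau> where "\<tau> = (y' - y) / real m"
      have "vertical_path y y' m x F (Suc i) = vertical_path y y' m x F i +
          \<tau> *\<^sub>R (vertical_path y y' m x F i ** N ((x, y) + (real i * \<tau>) *\<^sub>R (0, 1), \<tau>))" for i
      proof -
        have "division_point y y' m (Suc i) - division_point y y' m i = \<tau>"
          by (simp add: division_point_Suc_diff \<tau>_def)
        then show ?thesis
          by (simp add: vertical_step_def Let_def N_def r_def matrix_mult_step
              del: times_divide_eq_right)
            (simp add: division_point_def \<tau>_def)
      qed
      then show "norm (vertical_path y y' m x F m - F0 (x, y')) \<le> C * norm (F - F0 (x, y)) + \<eta>"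
        using \<delta>[of "(x, y)" "y' - y" m "vertical_path y y' m x F"] * by (simp add: \<tau>_def)
    qed
  qed
qed

section \<open>Chaining the two legs of each path\<close>

theorem theorem5p14:
  fixes x0 y0 a :: real
    and E :: "(real \<times> real) set"
    and F0 :: "real \<times> real \<Rightarrow> real^4^4"
    and s t :: "nat \<Rightarrow> real \<times> real \<Rightarrow> nat"
  assumes "(x0, y0) \<in> right_half_plane"
    and "a > 0"
    and "E = {x0..x0 + a} \<times> {y0..y0 + a}"
    and "E \<subseteq> right_half_plane"
    and "frame_field F0"
    and "\<And>n p. n > 0 \<Longrightarrow> p \<in> E \<Longrightarrow> admissible_division (x0, y0) a n p (s n p) (t n p)"
  shows "uniform_limit E (\<lambda>n p. lower_frame (x0, y0) (F0 (x0, y0)) p (s n p) (t n p)) F0 sequentially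
       \<and> uniform_limit E (\<lambda>n p. upper_frame (x0, y0) (F0 (x0, y0)) p (s n p) (t n p)) F0 sequentially"
proof -
  have E: "compact E" "convex E"
    unfolding assms(3) by (auto intro: compact_Times convex_Times)
  obtain C1 where C1: "C1 \<ge> 0" and hconv:
    "\<forall>\<eta>>0. \<exists>\<delta>>0. \<forall>x x' y m F. (x, y) \<in> E \<longrightarrow> (x', y) \<in> E \<longrightarrow> x \<le> x' \<longrightarrow> x' \<le> x + a \<longrightarrow>
          0 < m \<longrightarrow> (x' - x) / real m \<le> \<delta> \<longrightarrow>
          norm (horizontal_path x x' m y F m - F0 (x', y)) \<le> C1 * norm (F - F0 (x, y)) + \<eta>"
    using horizontal_path_convergence[OF E assms(4,5) less_imp_le[OF assms(2)]] by blast
  obtain C2 where C2: "C2 \<ge> 0" and vconv: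
    "\<forall>\<eta>>0. \<exists>\<delta>>0. \<forall>x y y' m F. (x, y) \<in> E \<longrightarrow> (x, y') \<in> E \<longrightarrow> y \<le> y' \<longrightarrow> y' \<le> y + a \<longrightarrow>
          0 < m \<longrightarrow> (y' - y) / real m \<le> \<delta> \<longrightarrow>
          norm (vertical_path y y' m x F m - F0 (x, y')) \<le> C2 * norm (F - F0 (x, y)) + \<eta>"
    using vertical_path_convergence[OF E assms(4,5) less_imp_le[OF assms(2)]] by blast
  have both: "\<forall>\<^sub>F n in sequentially. \<forall>p\<in>E.
      dist (lower_frame (x0, y0) (F0 (x0, y0)) p (s n p) (t n p)) (F0 p) < e \<and>
      dist (upper_frame (x0, y0) (F0 (x0, y0)) p (s n p) (t n p)) (F0 p) < e" if "e > 0" for e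
  proof -
    \<comment> \<open>The first leg ends with an error of at most \<open>\<eta>\<close>; the second
      multiplies it by \<open>C1\<close> or \<open>C2\<close> and adds another
      \<open>\<eta>\<close>. The denominator keeps both totals strictly below
      \<open>e\<close>.\<close>
    define \<eta> where "\<eta> = e / (C1 + C2 + 2)"
    have \<eta>: "\<eta> > 0" using that C1 C2 by (simp add: \<eta>_def)
    have "(C1 + C2 + 2) * \<eta> = e" using C1 C2 by (simp add: \<eta>_def)
    then have "C1 * \<eta> + C2 * \<eta> + 2 * \<eta> = e" by (simp add: algebra_simps)
    moreover have "C1 * \<eta> \<ge> 0" "C2 * \<eta> \<ge> 0" using C1 C2 \<eta> by auto
    ultimately have small: "C1 * \<eta> + \<eta> < e" "C2 * \<eta> + \<eta> < e" using \<eta> by linarith+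
    obtain \<delta>1 where \<delta>1: "\<delta>1 > 0" and h:
      "\<And>x x' y m F. (x, y) \<in> E \<Longrightarrow> (x', y) \<in> E \<Longrightarrow> x \<le> x' \<Longrightarrow> x' \<le> x + a \<Longrightarrow>
          0 < m \<Longrightarrow> (x' - x) / real m \<le> \<delta>1 \<Longrightarrow>
          norm (horizontal_path x x' m y F m - F0 (x', y)) \<le> C1 * norm (F - F0 (x, y)) + \<eta>"
      using hconv \<eta> by metis
    obtain \<delta>2 where \<delta>2: "\<delta>2 > 0" and v:
      "\<And>x y y' m F. (x, y) \<in> E \<Longrightarrow> (x, y') \<in> E \<Longrightarrow> y \<le> y' \<Longrightarrow> y' \<le> y + a \<Longrightarrow>
          0 < m \<Longrightarrow> (y' - y) / real m \<le> \<delta>2 \<Longrightarrow>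
          norm (vertical_path y y' m x F m - F0 (x, y')) \<le> C2 * norm (F - F0 (x, y)) + \<eta>"
      using vconv \<eta> by metis
    \<comment> \<open>All step lengths are at most \<open>a / real n\<close>, so one threshold on
      \<open>n\<close> serves every \<open>p \<in> E\<close>.\<close>
    have "(\<lambda>n. a / real n) \<longlonglongrightarrow> 0"
      by (rule lim_const_over_n)
    then have "\<forall>\<^sub>F n in sequentially. a / real n < min \<delta>1 \<delta>2"
      using \<delta>1 \<delta>2 by (intro order_tendstoD) auto
    then show ?thesis
      using eventually_gt_at_top[of 0]
    proof eventually_elim
      case (elim n)
      show ?case
      proof
        fix p assume p: "p \<in> E"
        obtain xp yp where p_eq: "p = (xp, yp)" by fastforce
        define k l where "k = s n p" and "l = t n p"
        have kl: "0 < k" "0 < l" "(xp - x0) / real k \<le> \<delta>1" "(yp - y0) / real l \<le> \<delta>2"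
          using assms(6)[OF elim(2) p] elim(1)
          by (auto simp: admissible_division_def p_eq k_def l_def)
        have box: "x0 \<le> xp" "xp \<le> x0 + a" "y0 \<le> yp" "yp \<le> y0 + a"
          and pts: "(x0, y0) \<in> E" "(xp, y0) \<in> E" "(x0, yp) \<in> E" "(xp, yp) \<in> E"
          using p assms(2,3) by (auto simp: p_eq)
        define Fh where "Fh = horizontal_path x0 xp k y0 (F0 (x0, y0)) k"
        define Fv where "Fv = vertical_path y0 yp l x0 (F0 (x0, y0)) l"
        \<comment> \<open>The first leg starts from the exact frame, so its initial error is
          0.\<close>
        have "norm (Fh - F0 (xp, y0)) \<le> \<eta>"
          using h[OF pts(1,2) box(1,2) kl(1,3), of "F0 (x0, y0)"] by (simp add: Fh_def)
        then have "C2 * norm (Fh - F0 (xp, y0)) \<le> C2 * \<eta>"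
          using C2 by (rule mult_left_mono)
        then have "dist (lower_frame (x0, y0) (F0 (x0, y0)) p k l) (F0 p) < e"
          using v[OF pts(2,4) box(3,4) kl(2,4), of Fh] small
          by (simp add: lower_frame_def Fh_def p_eq dist_norm)
        moreover have "norm (Fv - F0 (x0, yp)) \<le> \<eta>"
          using v[OF pts(1,3) box(3,4) kl(2,4), of "F0 (x0, y0)"] by (simp add: Fv_def)
        then have "C1 * norm (Fv - F0 (x0, yp)) \<le> C1 * \<eta>"
          using C1 by (rule mult_left_mono)
        then have "dist (upper_frame (x0, y0) (F0 (x0, y0)) p k l) (F0 p) < e"
          using h[OF pts(3,4) box(1,2) kl(1,3), of Fv] small
          by (simp add: upper_frame_def Fv_def p_eq dist_norm)
        ultimately show "dist (lower_frame (x0, y0) (F0 (x0, y0)) p (s n p) (t n p)) (F0 p) < e \<and>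
            dist (upper_frame (x0, y0) (F0 (x0, y0)) p (s n p) (t n p)) (F0 p) < e"
          by (simp add: k_def l_def)
      qed
    qed
  qed
  show ?thesis
    unfolding uniform_limit_iff by (auto intro: eventually_mono[OF both])
qed

end
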